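(* For any instance $\mathcal{I}$ of the online data markets game with transaction cost parameter $\alpha\in[0,1]$, the online cumulative welfare regret satisfies $$R_w(T;\mathcal{I})\le 2nT(1-\alpha)+2T\Delta_b^{max}+n\,R_d(T;\mathcal{I}),$$ where $R_d(T;\mathcal{I})=\max_i R_d^i(T;\mathcal{I})$ is the (per-buyer) expected online effective regret.
   Context: Setting: $n$ buyers, $k$ sellers; each buyer chooses a seller set $\gamma$ (a subset of the sellers). Buyer $i$'s random net gain is $G_i(\gamma)\in[-1,1]$ with mean $g_i(\gamma)$. Buyer $i$ suffers from buyer $j\ne i$ a nonnegative random externality $E_{ij}(\gamma_j)$ with mean $e_{ij}(\gamma_j)$, and $\sum_{j\ne i}E_{ji}(\gamma)\in[0,1]$ for all $i,\gamma$. The platform has random predictions $\hat{E}_{ij}(\gamma)$ with means $\hat{e}_{ij}(\gamma)$, also with $\sum_{j\ne i}\hat{E}_{ji}(\gamma)\in[0,1]$; the bias is $b_{ij}(\gamma)=e_{ij}(\gamma)-\hat{e}_{ij}(\gamma)$ and $\Delta_b^{max}=\sum_{i\ne j}\max_{\gamma^1,\gamma^2}|b_{ij}(\gamma^1)-b_{ij}(\gamma^2)|$ (sum over ordered pairs). In every round, for the order profile $S=(\gamma_1,\dots,\gamma_n)$, the platform charges buyer $i$ the transaction cost $\mathcal{T}_i(S)=\alpha\big(\sum_{j\ne i}\hat{E}_{ji}(\gamma_i)-\sum_{j\ne i}\hat{E}_{ij}(\gamma_j)\big)$, and buyer $i$'s utility is $G_i(\gamma_i)-\sum_{j\ne i}E_{ij}(\gamma_j)-\mathcal{T}_i(S)$.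 An instance is $\mathcal{I}=(g_i,e_{ij},b_{ij},\alpha)$. The expected effective utility of buyer $i$ is $u_i^e(\gamma)=g_i(\gamma)-\alpha\sum_{j\ne i}\hat{e}_{ji}(\gamma)$, and $\gamma_i^d\in\arg\max_\gamma u_i^e(\gamma)$. In rounds $t=1,\dots,T$ the buyers play profiles $S^t=(\gamma_1^t,\dots,\gamma_n^t)$ chosen by online learning algorithms. Expected online effective regret of buyer $i$: $R_d^i(T;\mathcal{I})=\mathbb{E}\big[\sum_{t=1}^T (u_i^e(\gamma_i^d)-u_i^e(\gamma_i^t))\big]$. Expected online cumulative welfare regret: with $S^*=(\gamma_1^*,\dots,\gamma_n^* )$ a profile maximizing the sum of the buyers' expected utilities (social welfare; the transaction costs sum to zero), $$R_w(T;\mathcal{I})=\mathbb{E}\Big[\sum_{i=1}^n\sum_{t=1}^T\Big(g_i(\gamma_i^* )-g_i(\gamma_i^t)-\sum_{j\ne i}\big(e_{ij}(\gamma_j^* )-e_{ij}(\gamma_j^t)\big)\Big)\Big].$$ *)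

theory Defs
  imports "HOL-Probability.Probability"
begin

text \<open>
  Buyers and sellers are the elements of the finite types \<open>'b\<close> and \<open>'s\<close>, so the number
  of buyers is \<open>CARD('b)\<close>; an order is an arbitrary set of sellers, and an order profile is
  a function from buyers to orders.

  \<open>externality I i j \<gamma>\<close> is what buyer \<open>i\<close> suffers when buyer \<open>j\<close> orders \<open>\<gamma>\<close>, and
  \<open>prediction I i j \<gamma>\<close> is the platform's prediction of it. Only the values for \<open>i \<noteq> j\<close>
  are meaningful. All of them are random variables on \<open>env I\<close>, which describes the
  randomness of a single round.
\<close>

type_synonym ('b, 's) profile = "'b \<Rightarrow> 's set"

record ('w, 'b, 's) data_market =
  env :: "'w measure"
  gain :: "'b \<Rightarrow> 's set \<Rightarrow> 'w \<Rightarrow> real"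
  externality :: "'b \<Rightarrow> 'b \<Rightarrow> 's set \<Rightarrow> 'w \<Rightarrow> real"
  prediction :: "'b \<Rightarrow> 'b \<Rightarrow> 's set \<Rightarrow> 'w \<Rightarrow> real"
  cost_param :: real

definition valid_market :: "('w, 'b::finite, 's::finite) data_market \<Rightarrow> bool" where
  "valid_market I \<longleftrightarrow>
     prob_space (env I) \<and>
     (\<forall>i \<gamma>. integrable (env I) (gain I i \<gamma>) \<and>
        (AE \<omega> in env I. gain I i \<gamma> \<omega> \<in> {-1..1})) \<and>
     (\<forall>i j \<gamma>. i \<noteq> j \<longrightarrow> integrable (env I) (externality I i j \<gamma>) \<and>
        (AE \<omega> in env I. 0 \<le> externality I i j \<gamma> \<omega>)) \<and>
     (\<forall>i \<gamma>. AE \<omega> in env I. (\<Sum>j\<in>UNIV - {i}. externality I j i \<gamma> \<omega>) \<in> {0..1}) \<and>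
     (\<forall>i j \<gamma>. i \<noteq> j \<longrightarrow> integrable (env I) (prediction I i j \<gamma>)) \<and>
     (\<forall>i \<gamma>. AE \<omega> in env I. (\<Sum>j\<in>UNIV - {i}. prediction I j i \<gamma> \<omega>) \<in> {0..1})"

definition mean_gain :: "('w, 'b, 's) data_market \<Rightarrow> 'b \<Rightarrow> 's set \<Rightarrow> real" where
  "mean_gain I i \<gamma> = (\<integral>\<omega>. gain I i \<gamma> \<omega> \<partial>env I)"

definition mean_ext :: "('w, 'b, 's) data_market \<Rightarrow> 'b \<Rightarrow> 'b \<Rightarrow> 's set \<Rightarrow> real" where
  "mean_ext I i j \<gamma> = (\<integral>\<omega>. externality I i j \<gamma> \<omega> \<partial>env I)"

definition mean_pred :: "('w, 'b, 's) data_market \<Rightarrow> 'b \<Rightarrow> 'b \<Rightarrow> 's set \<Rightarrow> real" where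
  "mean_pred I i j \<gamma> = (\<integral>\<omega>. prediction I i j \<gamma> \<omega> \<partial>env I)"

definition bias :: "('w, 'b, 's) data_market \<Rightarrow> 'b \<Rightarrow> 'b \<Rightarrow> 's set \<Rightarrow> real" where
  "bias I i j \<gamma> = mean_ext I i j \<gamma> - mean_pred I i j \<gamma>"

definition max_bias_gap :: "('w, 'b::finite, 's::finite) data_market \<Rightarrow> real" where
  "max_bias_gap I =
     (\<Sum>i\<in>UNIV. \<Sum>j\<in>UNIV - {i}.
        Max (range (\<lambda>(\<gamma>\<^sub>1, \<gamma>\<^sub>2). \<bar>bias I i j \<gamma>\<^sub>1 - bias I i j \<gamma>\<^sub>2\<bar>)))"

definition transaction_cost ::
    "('w, 'b::finite, 's) data_market \<Rightarrow> 'b \<Rightarrow> ('b, 's) profile \<Rightarrow> 'w \<Rightarrow> real" where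
  "transaction_cost I i S \<omega> =
     cost_param I *
       ((\<Sum>j\<in>UNIV - {i}. prediction I j i (S i) \<omega>)
        - (\<Sum>j\<in>UNIV - {i}. prediction I i j (S j) \<omega>))"

definition utility ::
    "('w, 'b::finite, 's) data_market \<Rightarrow> 'b \<Rightarrow> ('b, 's) profile \<Rightarrow> 'w \<Rightarrow> real" where
  "utility I i S \<omega> =
     gain I i (S i) \<omega> - (\<Sum>j\<in>UNIV - {i}. externality I i j (S j) \<omega>)
       - transaction_cost I i S \<omega>"

definition social_welfare ::
    "('w, 'b::finite, 's) data_market \<Rightarrow> ('b, 's) profile \<Rightarrow> real" where
  "social_welfare I S = (\<Sum>i\<in>UNIV. \<integral>\<omega>. utility I i S \<omega> \<partial>env I)"

definition effective_utility ::
    "('w, 'b::finite, 's) data_market \<Rightarrow> 'b \<Rightarrow> 's set \<Rightarrow> real" where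
  "effective_utility I i \<gamma> =
     mean_gain I i \<gamma> - cost_param I * (\<Sum>j\<in>UNIV - {i}. mean_pred I j i \<gamma>)"

text \<open>
  A run of the learning algorithms is a random sequence of profiles \<open>S t\<close> on a probability
  space \<open>P\<close>, carrying both the algorithms' own randomness and the feedback they receive.
  The dependence of \<open>S t\<close> on the earlier rounds is left unrestricted.
\<close>

definition is_run ::
    "'p measure \<Rightarrow> nat \<Rightarrow> (nat \<Rightarrow> 'p \<Rightarrow> ('b::finite, 's::finite) profile) \<Rightarrow> bool" where
  "is_run P T S \<longleftrightarrow>
     prob_space P \<and> (\<forall>t\<in>{1..T}. S t \<in> measurable P (count_space UNIV))"

definition effective_regret_of ::
    "('w, 'b::finite, 's::finite) data_market \<Rightarrow> ('b \<Rightarrow> 's set) \<Rightarrow> 'p measure \<Rightarrow>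
     (nat \<Rightarrow> 'p \<Rightarrow> ('b, 's) profile) \<Rightarrow> nat \<Rightarrow> 'b \<Rightarrow> real" where
  "effective_regret_of I \<gamma>d P S T i =
     (\<integral>x. (\<Sum>t=1..T. effective_utility I i (\<gamma>d i) - effective_utility I i (S t x i)) \<partial>P)"

definition effective_regret ::
    "('w, 'b::finite, 's::finite) data_market \<Rightarrow> ('b \<Rightarrow> 's set) \<Rightarrow> 'p measure \<Rightarrow>
     (nat \<Rightarrow> 'p \<Rightarrow> ('b, 's) profile) \<Rightarrow> nat \<Rightarrow> real" where
  "effective_regret I \<gamma>d P S T = Max (range (effective_regret_of I \<gamma>d P S T))"

definition welfare_regret ::
    "('w, 'b::finite, 's::finite) data_market \<Rightarrow> ('b, 's) profile \<Rightarrow> 'p measure \<Rightarrow>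
     (nat \<Rightarrow> 'p \<Rightarrow> ('b, 's) profile) \<Rightarrow> nat \<Rightarrow> real" where
  "welfare_regret I Sopt P S T =
     (\<integral>x. (\<Sum>i\<in>UNIV. \<Sum>t=1..T.
        mean_gain I i (Sopt i) - mean_gain I i (S t x i)
        - (\<Sum>j\<in>UNIV - {i}. mean_ext I i j (Sopt j) - mean_ext I i j (S t x j))) \<partial>P)"

end

theory Submission
  imports Defs
begin

text \<open>
  Charge each buyer for the externality it causes rather than the one it suffers: the welfare
  of a profile is the sum over \<open>i\<close> of \<open>g\<^sub>i(\<gamma>\<^sub>i) - (\<Sum>j\<noteq>i. e\<^sub>j\<^sub>i(\<gamma>\<^sub>i))\<close>. This summand differs
  from the effective utility of \<open>i\<close> by the biases and by \<open>(1 - \<alpha>)\<close> times the total predicted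
  externality of \<open>i\<close>, which lies in \<open>[0, 1]\<close>. Hence the welfare loss of a round is at most the
  effective utility loss plus \<open>n (1 - \<alpha>) + \<Delta>\<close>.
\<close>

text \<open>Over the full square the order of summation can be exchanged, and the diagonal terms
  removed from both sides are the same. This is what turns externalities suffered into externalities
  caused.\<close>

lemma sum_off_diagonal_swap:
  fixes f :: "'b::finite \<Rightarrow> 'b \<Rightarrow> 'a::ab_group_add"
  shows "(\<Sum>i\<in>UNIV. \<Sum>j\<in>UNIV - {i}. f i j) = (\<Sum>i\<in>UNIV. \<Sum>j\<in>UNIV - {i}. f j i)"
proof -
  have "(\<Sum>i\<in>UNIV. \<Sum>j\<in>UNIV. f i j) = (\<Sum>i\<in>UNIV. \<Sum>j\<in>UNIV. f j i)"
    by (rule sum.swap)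
  then show ?thesis
    by (simp add: sum_diff1 sum_subtractf)
qed

text \<open>A single prediction may be negative; the almost sure bound is on the total. So the
  expectation of the whole sum is bounded first, and linearity is applied afterwards.\<close>

lemma sum_mean_pred_bounds:
  fixes I :: "('w, 'b::finite, 's::finite) data_market"
  assumes "valid_market I"
  shows "(\<Sum>j\<in>UNIV - {i}. mean_pred I j i \<gamma>) \<in> {0..1}"
proof -
  interpret prob_space "env I"
    using assms by (simp add: valid_market_def)
  let ?X = "\<lambda>\<omega>. \<Sum>j\<in>UNIV - {i}. prediction I j i \<gamma> \<omega>"
  have int: "integrable (env I) (prediction I j i \<gamma>)" if "j \<in> UNIV - {i}" for j
    using assms that by (simp add: valid_market_def)
  have AE: "AE \<omega> in env I. ?X \<omega> \<in> {0..1}"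
    using assms by (simp add: valid_market_def)
  have "integrable (env I) ?X"
    using int by (rule Bochner_Integration.integrable_sum)
  then have "0 \<le> expectation ?X" and "expectation ?X \<le> 1"
    using AE by (auto intro!: integral_nonneg_AE integral_le_const elim: eventually_mono)
  moreover have "expectation ?X = (\<Sum>j\<in>UNIV - {i}. mean_pred I j i \<gamma>)"
    unfolding mean_pred_def using int by (rule Bochner_Integration.integral_sum)
  ultimately show ?thesis
    by simp
qed

lemma bias_gap_le_Max:
  fixes I :: "('w, 'b, 's::finite) data_market"
  shows "\<bar>bias I i j \<gamma>\<^sub>1 - bias I i j \<gamma>\<^sub>2\<bar>
    \<le> Max (range (\<lambda>(\<gamma>\<^sub>1, \<gamma>\<^sub>2). \<bar>bias I i j \<gamma>\<^sub>1 - bias I i j \<gamma>\<^sub>2\<bar>))"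
  by (rule Max_ge) (auto intro!: image_eqI[where x = "(\<gamma>\<^sub>1, \<gamma>\<^sub>2)"])

text \<open>Here the buyer whose order varies is the outer index, whereas in
  \<open>max_bias_gap\<close> it is the inner one. After exchanging the sums, each gap is below its
  maximum.\<close>

lemma sum_bias_gap_le_max_bias_gap:
  fixes I :: "('w, 'b::finite, 's::finite) data_market"
  shows "(\<Sum>i\<in>UNIV. \<Sum>j\<in>UNIV - {i}. \<bar>bias I j i (R i) - bias I j i (s i)\<bar>) \<le> max_bias_gap I"
proof -
  have "(\<Sum>i\<in>UNIV. \<Sum>j\<in>UNIV - {i}. \<bar>bias I j i (R i) - bias I j i (s i)\<bar>)
      = (\<Sum>i\<in>UNIV. \<Sum>j\<in>UNIV - {i}. \<bar>bias I i j (R j) - bias I i j (s j)\<bar>)"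
    by (rule sum_off_diagonal_swap)
  also have "\<dots> \<le> max_bias_gap I"
    unfolding max_bias_gap_def by (intro sum_mono bias_gap_le_Max)
  finally show ?thesis .
qed

lemma max_bias_gap_nonneg: "0 \<le> max_bias_gap I"
  \<comment> \<open>Any two profiles do, since the left side is a sum of absolute values.\<close>
  using sum_bias_gap_le_max_bias_gap[of I undefined undefined]
  by (meson abs_ge_zero order_trans sum_nonneg)

lemma welfare_loss_le_effective_loss:
  fixes I :: "('w, 'b::finite, 's::finite) data_market"
  assumes valid: "valid_market I"
    and \<alpha>: "cost_param I \<le> 1"
    and opt: "\<And>i \<gamma>. effective_utility I i \<gamma> \<le> effective_utility I i (\<gamma>d i)"
  shows "(\<Sum>i\<in>UNIV. mean_gain I i (R i) - mean_gain I i (s i)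
        - (\<Sum>j\<in>UNIV - {i}. mean_ext I i j (R j) - mean_ext I i j (s j)))
    \<le> (\<Sum>i\<in>UNIV. effective_utility I i (\<gamma>d i) - effective_utility I i (s i))
      + real CARD('b) * (1 - cost_param I) + max_bias_gap I"
proof -
  let ?\<alpha> = "cost_param I"
  let ?gap = "\<lambda>i. \<Sum>j\<in>UNIV - {i}. \<bar>bias I j i (R i) - bias I j i (s i)\<bar>"
  let ?p = "\<lambda>i \<gamma>. \<Sum>j\<in>UNIV - {i}. mean_pred I j i \<gamma>"
  \<comment> \<open>With the externality indices exchanged, the loss of buyer \<open>i\<close>
    depends on its own orders \<open>R i\<close> and \<open>s i\<close> only.\<close>
  have buyer: "mean_gain I i (R i) - mean_gain I i (s i)
        - (\<Sum>j\<in>UNIV - {i}. mean_ext I j i (R i) - mean_ext I j i (s i))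
      \<le> effective_utility I i (\<gamma>d i) - effective_utility I i (s i) + (1 - ?\<alpha>) + ?gap i" for i
  proof -
    \<comment> \<open>Mean externality is bias plus mean prediction. The share \<alpha> of the
      prediction is already charged in the effective utility; the share 1 - \<alpha> is left
      over.\<close>
    have "(\<Sum>j\<in>UNIV - {i}. mean_ext I j i (R i) - mean_ext I j i (s i))
        = (\<Sum>j\<in>UNIV - {i}. bias I j i (R i) - bias I j i (s i)) + (?p i (R i) - ?p i (s i))"
      by (simp add: bias_def sum_subtractf)
    moreover have "- (\<Sum>j\<in>UNIV - {i}. bias I j i (R i) - bias I j i (s i)) \<le> ?gap i"
      by (rule order_trans[OF abs_ge_minus_self sum_abs])
    \<comment> \<open>Two numbers in [0, 1] differ by at most 1, and 1 - \<alpha> is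
      non-negative.\<close>
    moreover have "(1 - ?\<alpha>) * (?p i (s i) - ?p i (R i)) \<le> 1 - ?\<alpha>"
      using \<alpha> sum_mean_pred_bounds[OF valid, of i "s i"] sum_mean_pred_bounds[OF valid, of i "R i"]
      by (intro mult_left_le) auto
    moreover have "effective_utility I i (R i) \<le> effective_utility I i (\<gamma>d i)"
      by (rule opt)
    ultimately show ?thesis
      by (simp add: effective_utility_def algebra_simps)
  qed
  have "(\<Sum>i\<in>UNIV. mean_gain I i (R i) - mean_gain I i (s i)
        - (\<Sum>j\<in>UNIV - {i}. mean_ext I i j (R j) - mean_ext I i j (s j)))
      = (\<Sum>i\<in>UNIV. mean_gain I i (R i) - mean_gain I i (s i)
        - (\<Sum>j\<in>UNIV - {i}. mean_ext I j i (R i) - mean_ext I j i (s i)))"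
    \<comment> \<open>Only the outer sums, over \<open>UNIV\<close>, are split below; the inner ones
      must stay whole to match this fact.\<close>
    using sum_off_diagonal_swap[of "\<lambda>i j. mean_ext I i j (R j) - mean_ext I i j (s j)"]
    by (simp only: sum_subtractf[of _ _ UNIV])
  also have "\<dots> \<le> (\<Sum>i\<in>UNIV. effective_utility I i (\<gamma>d i) - effective_utility I i (s i)
      + (1 - ?\<alpha>) + ?gap i)"
    by (intro sum_mono buyer)
  also have "\<dots> = (\<Sum>i\<in>UNIV. effective_utility I i (\<gamma>d i) - effective_utility I i (s i))
      + real CARD('b) * (1 - ?\<alpha>) + (\<Sum>i\<in>UNIV. ?gap i)"
    by (simp add: sum.distrib)
  finally show ?thesis
    using sum_bias_gap_le_max_bias_gap[of I R s] by linarith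
qed

text \<open>There are finitely many profiles, so every real function of the profile is bounded, and
  it is measurable on the discrete space.\<close>

lemma integrable_of_run:
  fixes h :: "('b::finite, 's::finite) profile \<Rightarrow> real"
  assumes "is_run P T S" and "t \<in> {1..T}"
  shows "integrable P (\<lambda>x. h (S t x))"
proof -
  interpret prob_space P
    using assms by (simp add: is_run_def)
  have [measurable]: "S t \<in> measurable P (count_space UNIV)"
    using assms by (simp add: is_run_def)
  have "norm (h s) \<le> Max (range (\<lambda>s. norm (h s)))" for s
    by (rule Max_ge) auto
  then show ?thesis
    by (intro integrable_const_bound[where B = "Max (range (\<lambda>s. norm (h s)))"]) auto
qed

lemma welfare_regret_le_sum_effective_regret:
  fixes I :: "('w, 'b::finite, 's::finite) data_market"
  assumes valid: "valid_market I"
    and \<alpha>: "cost_param I \<le> 1"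
    and run: "is_run P T S"
    and opt: "\<And>i \<gamma>. effective_utility I i \<gamma> \<le> effective_utility I i (\<gamma>d i)"
  shows "welfare_regret I R P S T
    \<le> real T * (real CARD('b) * (1 - cost_param I) + max_bias_gap I)
      + (\<Sum>i\<in>UNIV. effective_regret_of I \<gamma>d P S T i)"
proof -
  interpret prob_space P
    using run by (simp add: is_run_def)
  let ?c = "real CARD('b) * (1 - cost_param I) + max_bias_gap I"
  let ?w = "\<lambda>s. \<Sum>i\<in>UNIV. mean_gain I i (R i) - mean_gain I i (s i)
    - (\<Sum>j\<in>UNIV - {i}. mean_ext I i j (R j) - mean_ext I i j (s j))"
  let ?u = "\<lambda>i s. effective_utility I i (\<gamma>d i) - effective_utility I i (s i)"
  have int: "integrable P (\<lambda>x. \<Sum>t=1..T. h (S t x))" for h :: "('b, 's) profile \<Rightarrow> real"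
    using integrable_of_run[OF run] by (intro Bochner_Integration.integrable_sum) auto
  have "welfare_regret I R P S T = (\<integral>x. (\<Sum>t=1..T. ?w (S t x)) \<partial>P)"
    \<comment> \<open>The rounds become the outer sum, so that the bound for one round applies
      pointwise.\<close>
    unfolding welfare_regret_def by (subst sum.swap) (rule refl)
  also have "\<dots> \<le> (\<integral>x. real T * ?c + (\<Sum>i\<in>UNIV. \<Sum>t=1..T. ?u i (S t x)) \<partial>P)"
  proof (rule integral_mono)
    fix x
    have "(\<Sum>t=1..T. ?w (S t x)) \<le> (\<Sum>t=1..T. ?c + (\<Sum>i\<in>UNIV. ?u i (S t x)))"
      using welfare_loss_le_effective_loss[OF valid \<alpha> opt, of R]
      by (intro sum_mono) (simp add: add_ac)
    also have "\<dots> = real T * ?c + (\<Sum>i\<in>UNIV. \<Sum>t=1..T. ?u i (S t x))"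
      by (subst sum.swap) (simp add: sum.distrib)
    finally show "(\<Sum>t=1..T. ?w (S t x)) \<le> real T * ?c + (\<Sum>i\<in>UNIV. \<Sum>t=1..T. ?u i (S t x))" .
  qed (intro int Bochner_Integration.integrable_add Bochner_Integration.integrable_sum
      integrable_const)+
  also have "\<dots> = real T * ?c + (\<Sum>i\<in>UNIV. effective_regret_of I \<gamma>d P S T i)"
  proof -
    have ui: "integrable P (\<lambda>x. \<Sum>t=1..T. ?u i (S t x))" for i
      by (rule int)
    show ?thesis
      unfolding effective_regret_of_def
      by (subst Bochner_Integration.integral_add)
        (auto simp only: Bochner_Integration.integral_sum[OF ui] lebesgue_integral_const
          prob_space scaleR_one intro!: Bochner_Integration.integrable_sum ui integrable_const)
  qed
  finally show ?thesis .
qed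

theorem theorem4:
  fixes I :: "('w, 'b::finite, 's::finite) data_market"
    and \<gamma>d :: "'b \<Rightarrow> 's set"
    and Sopt :: "('b, 's) profile"
    and P :: "'p measure"
    and S :: "nat \<Rightarrow> 'p \<Rightarrow> ('b, 's) profile"
    and T :: nat
  assumes "valid_market I"
    and "cost_param I \<in> {0..1}"
    and "is_run P T S"
    and "\<And>i. is_arg_max (effective_utility I i) (\<lambda>_. True) (\<gamma>d i)"
    and "is_arg_max (social_welfare I) (\<lambda>_. True) Sopt"
  shows "welfare_regret I Sopt P S T
    \<le> 2 * real CARD('b) * real T * (1 - cost_param I)
      + 2 * real T * max_bias_gap I
      + real CARD('b) * effective_regret I \<gamma>d P S T"
proof -
  have opt: "effective_utility I i \<gamma> \<le> effective_utility I i (\<gamma>d i)" for i \<gamma>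
    using assms(4)[of i] by (simp add: is_arg_max_linorder)
  have \<alpha>: "cost_param I \<le> 1"
    using assms(2) by simp
  \<comment> \<open>Each of the n regrets is at most their maximum.\<close>
  have "(\<Sum>i\<in>UNIV. effective_regret_of I \<gamma>d P S T i) \<le> real CARD('b) * effective_regret I \<gamma>d P S T"
    unfolding effective_regret_def by (rule sum_bounded_above) simp
  \<comment> \<open>The bound already holds with this term once; adding it again gives the factors
    2.\<close>
  moreover have "0 \<le> real T * (real CARD('b) * (1 - cost_param I) + max_bias_gap I)"
    using \<alpha> max_bias_gap_nonneg[of I] by simp
  ultimately show ?thesis
    using welfare_regret_le_sum_effective_regret[OF assms(1) \<alpha> assms(3) opt, of Sopt]
    by (simp add: algebra_simps)
qed

end
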